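(* Let $k\ge 1$, let $\pi\in\mathfrak S_k$, and let $R\subseteq\{0,1,\ldots,k\}^2$, so that $(\pi,R)$ is a mesh pattern. Then there exists a set $S$ of classical patterns with $\mathrm{Av}((\pi,R))=\mathrm{Av}(S)$ if and only if $(\pi,R)$ has no enclosed diagonals. Moreover, if $(\pi,R)$ has no enclosed diagonals and $S(\pi,R)$ is a set of classical patterns of minimal cardinality among all sets $S$ of classical patterns satisfying $\mathrm{Av}((\pi,R))=\mathrm{Av}(S)$, then $S(\pi,R)=\{\pi\}$; so $\mathrm{Av}((\pi,R))=\mathrm{Av}(\pi)$, i.e. $(\pi,R)$ is coincident to $\pi$.
   Context: Permutations: $\mathfrak S_n$ is the set of permutations of $[n]=\{1,\ldots,n\}$, $n\ge 1$. For $\pi\in\mathfrak S_k$, its graph is $G(\pi)=\{(i,\pi(i)):1\le i\le k\}$. Classical patterns: a classical pattern is a permutation $\pi\in\mathfrak S_k$. An occurrence of $\pi$ in $\sigma\in\mathfrak S_n$ is a choice of indices $i_1<\cdots<i_k$ in $[n]$ such that $\sigma(i_1)\cdots\sigma(i_k)$ is in the same relative order as $\pi(1)\cdots\pi(k)$. The permutation $\sigma$ contains $\pi$ if there is an occurrence of $\pi$ in $\sigma$, and avoids $\pi$ otherwise (in particular if $n<k$). Mesh patterns: a mesh pattern is a pair $(\pi,R)$ with $\pi\in\mathfrak S_k$ and $R\subseteq\{0,\ldots,k\}^2$; the element $(a,b)\in R$ represents the unit square $[a,a+1]\times[b,b+1]$ with lower-left corner $(a,b)$. A permutation $\sigma\in\mathfrak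 S_n$ contains $(\pi,R)$ if there is an occurrence $i_1<\cdots<i_k$ of $\pi$ in $\sigma$ such that the following holds. Let $v_1<\cdots<v_k$ be the values $\sigma(i_1),\ldots,\sigma(i_k)$ in increasing order, and set $i_0=v_0=0$, $i_{k+1}=v_{k+1}=n+1$. Then for every $(a,b)\in R$ there is no $t\in[n]$ with $i_a<t<i_{a+1}$ and $v_b<\sigma(t)<v_{b+1}$. Otherwise $\sigma$ avoids $(\pi,R)$. For a (classical or mesh) pattern $p$, $\mathrm{Av}(p)$ is the set of all permutations (of all sizes $n\ge1$) that avoid $p$; for a set $P$ of patterns, $\mathrm{Av}(P)=\bigcap_{p\in P}\mathrm{Av}(p)$. Two patterns or sets of patterns are coincident if their sets $\mathrm{Av}(\cdot)$ are equal. Enclosed diagonals: an enclosed diagonal in $(\pi,R)$, where $\pi \in \mathfrak S_k$, is a triple $((i,j),\varepsilon,h)$ with integers $i,j$, $\varepsilon\in\{-1,1\}$, $h\ge1$, satisfying the following (points outside $[k]^2$ are never in $G(\pi)$). (1) If $h=1$ (then $\varepsilon$ is irrelevant): $(i,j)\in R$ and none of the four corners $(i,j),(i+1,j),(i,j+1),(i+1,j+1)$ of that square is in $G(\pi)$. (2) If $h\ge2$ and $\varepsilon=1$: $(i+x,j+x)\in R$ for all $0\le x<h$; $(i+x,j+x)\in G(\pi)$ for all $1\le x<h$; and $(i,j)\notin G(\pi)$, $(i+h,j+h)\notin G(\pi)$. (3) If $h\ge2$ and $\varepsilon=-1$: $(i+x,j-x)\in R$ for all $0\le x<h$; $(i+x,j+1-x)\in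 G(\pi)$ for all $1\le x<h$; and $(i,j+1)\notin G(\pi)$, $(i+h,j+1-h)\notin G(\pi)$. That is, a maximal diagonal run of consecutive points of $G(\pi)$ such that the squares before, between and after them along that diagonal are all in $R$, or (for $h=1$) a single square of $R$ with no corner in $G(\pi)$. *)

theory Defs
  imports "HOL-Combinatorics.Permutations" "HOL-Library.Equipollence"
begin

text \<open>
  A permutation of \<open>[n] = {1..n}\<close> is represented together with its size, as a pair
  \<open>(n, \<sigma>)\<close>. The size has to be recorded: the function \<open>\<sigma>\<close> alone, being
  the identity outside \<open>{1..n}\<close>, does not determine it.
\<close>

type_synonym perm = "nat \<times> (nat \<Rightarrow> nat)"

definition perms :: "perm set" where
  "perms = {(n, \<sigma>). 1 \<le> n \<and> \<sigma> permutes {1..n}}"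

fun occurrence :: "perm \<Rightarrow> perm \<Rightarrow> (nat \<Rightarrow> nat) \<Rightarrow> bool" where
  "occurrence (k, \<pi>) (n, \<sigma>) i \<longleftrightarrow>
     i ` {1..k} \<subseteq> {1..n} \<and> strict_mono_on {1..k} i \<and>
     (\<forall>a\<in>{1..k}. \<forall>b\<in>{1..k}. \<sigma> (i a) < \<sigma> (i b) \<longleftrightarrow> \<pi> a < \<pi> b)"

definition contains :: "perm \<Rightarrow> perm \<Rightarrow> bool" where
  "contains s p \<longleftrightarrow> (\<exists>i. occurrence p s i)"

definition Av :: "perm \<Rightarrow> perm set" where
  "Av p = {s \<in> perms. \<not> contains s p}"

text \<open>The empty intersection is the set of all permutations.\<close>

definition Av_set :: "perm set \<Rightarrow> perm set" where
  "Av_set P = perms \<inter> (\<Inter>p\<in>P. Av p)"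

type_synonym mesh_pattern = "perm \<times> (nat \<times> nat) set"

text \<open>
  For a sequence \<open>f 1 < \<dots> < f k\<close> in \<open>{1..n}\<close>, adds the conventions
  \<open>f 0 = 0\<close> and \<open>f (k + 1) = n + 1\<close>.
\<close>

definition with_boundary :: "nat \<Rightarrow> nat \<Rightarrow> (nat \<Rightarrow> nat) \<Rightarrow> nat \<Rightarrow> nat" where
  "with_boundary k n f a = (if a = 0 then 0 else if a = k + 1 then n + 1 else f a)"

text \<open>
  The \<open>b\<close>-th smallest of the values \<open>\<sigma> (i 1), \<dots>, \<sigma> (i k)\<close>, for
  \<open>b \<in> {1..k}\<close>; list positions start at 0.
\<close>

definition sorted_values :: "nat \<Rightarrow> (nat \<Rightarrow> nat) \<Rightarrow> (nat \<Rightarrow> nat) \<Rightarrow> nat \<Rightarrow> nat" where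
  "sorted_values k \<sigma> i b = sorted_list_of_set (\<sigma> ` i ` {1..k}) ! (b - 1)"

fun mesh_occurrence :: "mesh_pattern \<Rightarrow> perm \<Rightarrow> (nat \<Rightarrow> nat) \<Rightarrow> bool" where
  "mesh_occurrence ((k, \<pi>), R) (n, \<sigma>) i \<longleftrightarrow>
     occurrence (k, \<pi>) (n, \<sigma>) i \<and>
     (let I = with_boundary k n i; V = with_boundary k n (sorted_values k \<sigma> i)
      in \<forall>(a, b)\<in>R. \<not> (\<exists>t\<in>{1..n}.
           I a < t \<and> t < I (a + 1) \<and> V b < \<sigma> t \<and> \<sigma> t < V (b + 1)))"

definition mesh_contains :: "perm \<Rightarrow> mesh_pattern \<Rightarrow> bool" where
  "mesh_contains s m \<longleftrightarrow> (\<exists>i. mesh_occurrence m s i)"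

definition mesh_Av :: "mesh_pattern \<Rightarrow> perm set" where
  "mesh_Av m = {s \<in> perms. \<not> mesh_contains s m}"

text \<open>
  Enclosed diagonals are located by integer coordinates, so the graph and the shading are
  viewed inside \<open>int \<times> int\<close>; this avoids truncated subtraction.
\<close>

fun perm_graph :: "perm \<Rightarrow> (int \<times> int) set" where
  "perm_graph (k, \<pi>) = (\<lambda>i. (int i, int (\<pi> i))) ` {1..k}"

fun enclosed_diagonal :: "mesh_pattern \<Rightarrow> (int \<times> int) \<times> int \<times> int \<Rightarrow> bool" where
  "enclosed_diagonal (p, R) ((i, j), \<epsilon>, h) \<longleftrightarrow>
     (let G = perm_graph p; Q = map_prod int int ` R in
        \<epsilon> \<in> {- 1, 1} \<and> h \<ge> 1 \<and>
        (h = 1 \<longrightarrow>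
           (i, j) \<in> Q \<and>
           (i, j) \<notin> G \<and> (i + 1, j) \<notin> G \<and> (i, j + 1) \<notin> G \<and> (i + 1, j + 1) \<notin> G) \<and>
        (h \<ge> 2 \<and> \<epsilon> = 1 \<longrightarrow>
           (\<forall>x. 0 \<le> x \<and> x < h \<longrightarrow> (i + x, j + x) \<in> Q) \<and>
           (\<forall>x. 1 \<le> x \<and> x < h \<longrightarrow> (i + x, j + x) \<in> G) \<and>
           (i, j) \<notin> G \<and> (i + h, j + h) \<notin> G) \<and>
        (h \<ge> 2 \<and> \<epsilon> = - 1 \<longrightarrow>
           (\<forall>x. 0 \<le> x \<and> x < h \<longrightarrow> (i + x, j - x) \<in> Q) \<and>
           (\<forall>x. 1 \<le> x \<and> x < h \<longrightarrow> (i + x, j + 1 - x) \<in> G) \<and>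
           (i, j + 1) \<notin> G \<and> (i + h, j + 1 - h) \<notin> G))"

definition classical_description :: "mesh_pattern \<Rightarrow> perm set \<Rightarrow> bool" where
  "classical_description m S \<longleftrightarrow> S \<subseteq> perms \<and> mesh_Av m = Av_set S"

text \<open>
  Cardinalities are compared by \<open>\<lesssim>\<close> rather than \<open>card\<close>, since
  \<open>S\<close> may be infinite.
\<close>

definition minimal_classical_description :: "mesh_pattern \<Rightarrow> perm set \<Rightarrow> bool" where
  "minimal_classical_description m S \<longleftrightarrow>
     classical_description m S \<and> (\<forall>T. classical_description m T \<longrightarrow> S \<lesssim> T)"

end

theory Submission
  imports Defs
begin

text \<open>
  If there is no enclosed diagonal, every maximal diagonal run of points of \<open>\<pi>\<close> passes at
  least one unshaded square. Push the points of an occurrence of \<open>\<pi>\<close> away from such a square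
  along their diagonals: a point lying in a shaded square can always replace a corner of that square.
  Each point of the occurrence moves monotonically in one coordinate, so this terminates,
  and it can only stop at an occurrence of \<open>(\<pi>, R)\<close>.

  An enclosed diagonal can be lengthened by inserting a point into its first square. Deleting a point
  of the new permutation gives back \<open>\<pi>\<close> only if that point lies on the lengthened run, hence in a
  shaded square. So this permutation contains \<open>\<pi>\<close> but avoids \<open>(\<pi>, R)\<close>, whereas
  \<open>\<pi>\<close> contains \<open>(\<pi>, R)\<close>: the avoidance set is not closed under taking patterns.
\<close>

section \<open>Positions and values of an occurrence\<close>

lemma sorted_list_of_set_image_nth:
  fixes f :: "nat \<Rightarrow> nat"
  assumes "strict_mono_on {1..k} f" "b \<in> {1..k}"
  shows "sorted_list_of_set (f ` {1..k}) ! (b - 1) = f b"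
proof -
  have "sorted_wrt (<) (map f [1..<k + 1])"
    using assms(1) by (auto simp: sorted_wrt_iff_nth_less strict_mono_on_def simp del: upt_Suc)
  moreover have "set (map f [1..<k + 1]) = f ` {1..k}"
    by auto
  ultimately have "sorted_list_of_set (f ` {1..k}) = map f [1..<k + 1]"
    by (intro strict_sorted_equal) (auto simp del: upt_Suc)
  then show ?thesis
    using assms(2) by (auto simp del: upt_Suc simp: nth_append)
qed

lemma strict_mono_on_unique:
  fixes f g :: "nat \<Rightarrow> nat"
  assumes "strict_mono_on {1..k} f" "strict_mono_on {1..k} g" "f ` {1..k} = g ` {1..k}" "b \<in> {1..k}"
  shows "f b = g b"
  using sorted_list_of_set_image_nth assms by metis

lemma occurrenceD:
  assumes "occurrence (k, \<pi>) (n, \<sigma>) i"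
  shows "strict_mono_on {1..k} i" "i ` {1..k} \<subseteq> {1..n}"
    and "a \<in> {1..k} \<Longrightarrow> i a \<in> {1..n}"
    and "a \<in> {1..k} \<Longrightarrow> b \<in> {1..k} \<Longrightarrow> \<sigma> (i a) < \<sigma> (i b) \<longleftrightarrow> \<pi> a < \<pi> b"
  using assms unfolding occurrence.simps by blast+

text \<open>Reading the values of an occurrence in the order given by \<open>inv \<pi>\<close> lists
  them increasingly, so this composition enumerates the rows of the occurrence from bottom to
  top.\<close>

lemma occurrence_standardize:
  assumes "\<pi> permutes {1..k}" "occurrence (k, \<pi>) (n, \<sigma>) i"
  shows "strict_mono_on {1..k} (\<sigma> \<circ> i \<circ> inv \<pi>)" "(\<sigma> \<circ> i \<circ> inv \<pi>) ` {1..k} = \<sigma> ` i ` {1..k}"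
proof -
  have inv: "inv \<pi> permutes {1..k}"
    using assms(1) by (rule permutes_inv)
  show "(\<sigma> \<circ> i \<circ> inv \<pi>) ` {1..k} = \<sigma> ` i ` {1..k}"
    using permutes_image[OF inv] by (metis image_comp)
  show "strict_mono_on {1..k} (\<sigma> \<circ> i \<circ> inv \<pi>)"
  proof (rule strict_mono_onI)
    fix r s assume rs: "r \<in> {1..k}" "s \<in> {1..k}" "r < s"
    then have "inv \<pi> r \<in> {1..k}" "inv \<pi> s \<in> {1..k}"
      using permutes_in_image[OF inv] by blast+
    moreover have "\<pi> (inv \<pi> r) < \<pi> (inv \<pi> s)"
      using rs permutes_inverses[OF assms(1)] by simp
    ultimately show "(\<sigma> \<circ> i \<circ> inv \<pi>) r < (\<sigma> \<circ> i \<circ> inv \<pi>) s"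
      using occurrenceD(4)[OF assms(2)] by simp
  qed
qed

lemma occurrence_sorted_values:
  assumes "\<pi> permutes {1..k}" "occurrence (k, \<pi>) (n, \<sigma>) i" "d \<in> {1..k}"
  shows "sorted_values k \<sigma> i (\<pi> d) = \<sigma> (i d)"
proof -
  have "\<pi> d \<in> {1..k}"
    using permutes_in_image[OF assms(1)] assms(3) by blast
  from sorted_list_of_set_image_nth[OF occurrence_standardize(1)[OF assms(1,2)] this]
  show ?thesis
    unfolding sorted_values_def occurrence_standardize(2)[OF assms(1,2)]
    using permutes_inverses[OF assms(1)] by simp
qed

lemma with_boundary_bounds:
  assumes "strict_mono_on {1..k} f" "f ` {1..k} \<subseteq> {1..n}" "d \<in> {1..k}"
  shows "d \<le> a \<Longrightarrow> a \<le> k \<Longrightarrow> f d \<le> with_boundary k n f a"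
    and "a \<le> d \<Longrightarrow> with_boundary k n f a \<le> f d"
  using strict_mono_on_leD[OF assms(1)] assms(3) by (auto simp: with_boundary_def)

text \<open>The shading condition compares a point only with the grid lines around its square. By
  monotonicity the point then lies on a known side of every point of the occurrence, which is the
  form needed for exchanging points.\<close>

lemma box_bounds:
  assumes \<pi>: "\<pi> permutes {1..k}" and \<sigma>: "\<sigma> permutes {1..n}"
    and occ: "occurrence (k, \<pi>) (n, \<sigma>) i"
    and I: "with_boundary k n i a < t" "t < with_boundary k n i (a + 1)"
    and V: "with_boundary k n (sorted_values k \<sigma> i) b < \<sigma> t"
      "\<sigma> t < with_boundary k n (sorted_values k \<sigma> i) (b + 1)"
    and ab: "a \<le> k" "b \<le> k" and d: "d \<in> {1..k}"
  shows "d \<le> a \<Longrightarrow> i d < t" "a < d \<Longrightarrow> t < i d"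
    and "\<pi> d \<le> b \<Longrightarrow> \<sigma> (i d) < \<sigma> t" "b < \<pi> d \<Longrightarrow> \<sigma> t < \<sigma> (i d)"
proof -
  let ?w = "\<sigma> \<circ> i \<circ> inv \<pi>" and ?v = "sorted_values k \<sigma> i"
  have w: "strict_mono_on {1..k} ?w" "?w ` {1..k} = \<sigma> ` i ` {1..k}"
    using occurrence_standardize[OF \<pi> occ] by auto
  have vw: "?v b = ?w b" if "b \<in> {1..k}" for b
    using sorted_list_of_set_image_nth[OF w(1) that] unfolding sorted_values_def w(2) .
  have v: "strict_mono_on {1..k} ?v"
    using w(1) vw by (auto simp: strict_mono_on_def)
  have "?w ` {1..k} \<subseteq> {1..n}"
    using occurrenceD(2)[OF occ] permutes_in_image[OF \<sigma>] unfolding w(2) by blast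
  then have v': "?v ` {1..k} \<subseteq> {1..n}"
    using vw by auto
  have i: "strict_mono_on {1..k} i" "i ` {1..k} \<subseteq> {1..n}"
    using occurrenceD[OF occ] by blast+
  have \<pi>d: "\<pi> d \<in> {1..k}"
    using permutes_in_image[OF \<pi>] d by blast
  have vd: "?v (\<pi> d) = \<sigma> (i d)"
    using occurrence_sorted_values[OF \<pi> occ d] .
  show "i d < t" if "d \<le> a"
    using with_boundary_bounds(1)[OF i d that ab(1)] I by linarith
  show "t < i d" if "a < d"
    using with_boundary_bounds(2)[OF i d, of "a + 1"] I that by linarith
  show "\<sigma> (i d) < \<sigma> t" if "\<pi> d \<le> b"
    using with_boundary_bounds(1)[OF v v' \<pi>d that ab(2)] V vd by linarith
  show "\<sigma> t < \<sigma> (i d)" if "b < \<pi> d"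
    using with_boundary_bounds(2)[OF v v' \<pi>d, of "b + 1"] V vd that by linarith
qed

section \<open>Pushing points along diagonals\<close>

text \<open>No other row or column of the occurrence separates the open square \<open>(a, b)\<close>
  from its corner \<open>c\<close>, so the point at \<open>t\<close> compares with all remaining
  points exactly as the point of \<open>c\<close> does.\<close>

lemma occurrence_move_corner:
  assumes \<pi>: "\<pi> permutes {1..k}"
    and occ: "occurrence (k, \<pi>) (n, \<sigma>) i" and t: "t \<in> {1..n}"
    and box: "\<And>d. d \<in> {1..k} \<Longrightarrow> d \<le> a \<Longrightarrow> i d < t" "\<And>d. d \<in> {1..k} \<Longrightarrow> a < d \<Longrightarrow> t < i d"
      "\<And>d. d \<in> {1..k} \<Longrightarrow> \<pi> d \<le> b \<Longrightarrow> \<sigma> (i d) < \<sigma> t"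
      "\<And>d. d \<in> {1..k} \<Longrightarrow> b < \<pi> d \<Longrightarrow> \<sigma> t < \<sigma> (i d)"
    and c: "c \<in> {1..k}" "c = a \<or> c = a + 1" "\<pi> c = b \<or> \<pi> c = b + 1"
  shows "occurrence (k, \<pi>) (n, \<sigma>) (i(c := t))"
proof -
  let ?i = "i(c := t)"
  have "strict_mono_on {1..k} ?i"
  proof (rule strict_mono_onI)
    fix r s assume rs: "r \<in> {1..k}" "s \<in> {1..k}" "r < s"
    have "i r < i s"
      using strict_mono_onD[OF occurrenceD(1)[OF occ] rs] .
    moreover have "s = c \<Longrightarrow> i r < t" "r = c \<Longrightarrow> t < i s"
      using rs c(2) by (auto intro: box(1) box(2))
    ultimately show "?i r < ?i s"
      using rs by auto
  qed
  moreover have "\<sigma> (?i r) < \<sigma> (?i s) \<longleftrightarrow> \<pi> r < \<pi> s" if rs: "r \<in> {1..k}" "s \<in> {1..k}" for r s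
  proof -
    have *: "\<sigma> (i r) < \<sigma> (i s) \<longleftrightarrow> \<pi> r < \<pi> s"
      using occurrenceD(4)[OF occ rs] .
    have side: "(\<pi> d \<le> b \<longleftrightarrow> \<pi> d < \<pi> c) \<and> (b < \<pi> d \<longleftrightarrow> \<pi> c < \<pi> d)" if "d \<noteq> c" for d
    proof -
      have "\<pi> d \<noteq> \<pi> c"
        using that inj_eq[OF permutes_inj[OF \<pi>]] by simp
      then show ?thesis using c(3) by auto
    qed
    have lo: "\<sigma> (i d) < \<sigma> t \<longleftrightarrow> \<pi> d < \<pi> c" and hi: "\<sigma> t < \<sigma> (i d) \<longleftrightarrow> \<pi> c < \<pi> d"
      if "d \<in> {1..k}" "d \<noteq> c" for d
      using side[OF that(2)] box(3,4)[OF that(1)] by (meson linorder_not_le order_less_asym)+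
    show ?thesis
      using * lo hi rs by auto
  qed
  moreover have "?i ` {1..k} \<subseteq> {1..n}"
    using occurrenceD(3)[OF occ] t by auto
  ultimately show ?thesis
    by simp
qed

text \<open>
  Along a diagonal, \<open>g x\<close> says that the lattice point number \<open>x\<close> belongs to the graph and
  \<open>q x\<close> that the square between the points \<open>x\<close> and \<open>x + 1\<close> is shaded. Points with a
  gap behind them are pushed forwards, the others backwards.
\<close>

definition chain_gap :: "(int \<Rightarrow> bool) \<Rightarrow> (int \<Rightarrow> bool) \<Rightarrow> int \<Rightarrow> bool" where
  "chain_gap g q z \<longleftrightarrow> (\<exists>x\<ge>1. (\<forall>y. 0 \<le> y \<and> y < x \<longrightarrow> g (z - y)) \<and> \<not> q (z - x))"

text \<open>If point \<open>z + 1\<close> is in the graph and has a gap behind it, the gap lies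
  beyond the shaded square \<open>z\<close>, so point \<open>z\<close> is in the graph too and has
  the same gap. If only point \<open>z\<close> is in the graph and has no gap behind it, its run is
  an enclosed diagonal. Hence one of the two ends is always pushed into the square
  \<open>z\<close>.\<close>

lemma chain_gap_choice:
  assumes q: "q z" and g: "g z \<or> g (z + 1)" and bounded: "\<And>x. x \<le> 0 \<Longrightarrow> \<not> g x"
    and not_enclosed: "\<And>i h. h \<ge> 2 \<Longrightarrow> (\<forall>x. 0 \<le> x \<and> x < h \<longrightarrow> q (i + x)) \<Longrightarrow>
      (\<forall>x. 1 \<le> x \<and> x < h \<longrightarrow> g (i + x)) \<Longrightarrow> \<not> g i \<Longrightarrow> \<not> g (i + h) \<Longrightarrow> False"
  shows "(g z \<and> chain_gap g q z) \<or> (g (z + 1) \<and> \<not> chain_gap g q (z + 1))"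
proof (rule ccontr)
  assume neg: "\<not> ?thesis"
  have no: "\<not> g (z + 1)"
  proof
    assume "g (z + 1)"
    then have "chain_gap g q (z + 1)" using neg by blast
    then obtain x where x: "x \<ge> 1" "\<And>y. 0 \<le> y \<Longrightarrow> y < x \<Longrightarrow> g (z + 1 - y)" "\<not> q (z + 1 - x)"
      unfolding chain_gap_def by blast
    have "x \<noteq> 1" using x(3) q by auto
    then have x2: "x \<ge> 2" using x(1) by linarith
    have gy: "g (z - y)" if "0 \<le> y" "y < x - 1" for y
      using x(2)[of "y + 1"] that by (simp add: algebra_simps)
    have "chain_gap g q z"
      unfolding chain_gap_def using gy x(3) x2
      by (intro exI[of _ "x - 1"]) (auto simp: algebra_simps)
    moreover have "g z" using gy[of 0] x2 by simp
    ultimately show False using neg by blast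
  qed
  then have gz: "g z" using g by blast
  have "\<exists>m::nat. \<not> g (z - int m)"
    using bounded[of "z - int (nat z)"] by (intro exI[of _ "nat z"]) linarith
  \<comment> \<open>The run of graph points ending at \<open>z\<close> has \<open>m\<close> points;
    the \<open>m + 1\<close> squares along it are those from \<open>z - m\<close> to
    \<open>z\<close>.\<close>
  define m where "m = (LEAST m::nat. \<not> g (z - int m))"
  have m: "\<not> g (z - int m)"
    unfolding m_def by (rule LeastI_ex) fact
  have gm: "g (z - y)" if "0 \<le> y" "y < int m" for y
    using not_less_Least[of "nat y" "\<lambda>m. \<not> g (z - int m)"] that unfolding m_def by auto
  have "m \<noteq> 0" using m gz by (metis diff_zero of_nat_0)
  have "\<not> chain_gap g q z" using neg gz by blast
  then have qm: "q (z - y)" if "1 \<le> y" "y \<le> int m" for y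
    using that gm unfolding chain_gap_def by (meson order_less_le_trans)
  show False
  proof (rule not_enclosed[of "int m + 1" "z - int m"])
    show "\<forall>x. 0 \<le> x \<and> x < int m + 1 \<longrightarrow> q (z - int m + x)"
    proof (intro allI impI)
      fix x assume x: "0 \<le> x \<and> x < int m + 1"
      show "q (z - int m + x)"
        using qm[of "int m - x"] q x by (cases "x = int m") (auto simp: algebra_simps)
    qed
    show "\<forall>x. 1 \<le> x \<and> x < int m + 1 \<longrightarrow> g (z - int m + x)"
    proof (intro allI impI)
      fix x assume x: "1 \<le> x \<and> x < int m + 1"
      then show "g (z - int m + x)"
        using gm[of "int m - x"] by (auto simp: algebra_simps)
    qed
  qed (use \<open>m \<noteq> 0\<close> m no in auto)
qed

lemma mem_shading_iff [simp]: "(int a, int b) \<in> map_prod int int ` R \<longleftrightarrow> (a, b) \<in> R"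
  by force

lemma mem_perm_graph_iff [simp]: "(int a, int b) \<in> perm_graph (k, \<pi>) \<longleftrightarrow> a \<in> {1..k} \<and> \<pi> a = b"
  by auto

text \<open>An occurrence with the largest sum \<open>\<Phi>\<close> respects the shading: a point
  in a shaded square could replace a corner whose prescribed direction leads into this square, and
  \<open>\<Phi>\<close> would grow.\<close>

lemma contains_imp_mesh_contains:
  assumes \<pi>: "\<pi> permutes {1..k}" and R: "R \<subseteq> {0..k} \<times> {0..k}"
    and no_diag: "\<nexists>d. enclosed_diagonal ((k, \<pi>), R) d"
    and \<sigma>: "\<sigma> permutes {1..n}" and cont: "contains (n, \<sigma>) (k, \<pi>)"
  shows "mesh_contains (n, \<sigma>) ((k, \<pi>), R)"
proof -
  define G where "G = perm_graph (k, \<pi>)"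
  define Q where "Q = map_prod int int ` R"
  define gi where "gi c x \<longleftrightarrow> (x, c + x) \<in> G" for c x
  define qi where "qi c x \<longleftrightarrow> (x, c + x) \<in> Q" for c x
  \<comment> \<open>On a falling diagonal the square with lower-left corner
    \<open>(x, c - x)\<close> lies between the lattice points \<open>(x, c + 1 - x)\<close> and
    \<open>(x + 1, c - x)\<close>, which are its points \<open>x\<close> and \<open>x + 1\<close>.
    The point of column \<open>a\<close> therefore has diagonal index
    \<open>\<pi> a + a - 1\<close>.\<close>
  define gd where "gd c x \<longleftrightarrow> (x, c + 1 - x) \<in> G" for c x
  define qd where "qd c x \<longleftrightarrow> (x, c - x) \<in> Q" for c x
  define inc where "inc a \<longleftrightarrow> chain_gap (gi (int (\<pi> a) - int a)) (qi (int (\<pi> a) - int a)) (int a)" for a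
  define dec where "dec a \<longleftrightarrow>
    chain_gap (gd (int (\<pi> a) + int a - 1)) (qd (int (\<pi> a) + int a - 1)) (int a)" for a
  \<comment> \<open>A point moves to NE if \<open>inc\<close> and to SW otherwise, and to SE if \<open>dec\<close> and to NW
    otherwise. For each combination, \<open>weight\<close> is the (possibly reversed) coordinate that both moves increase.\<close>
  define weight where "weight a t =
    (if inc a then (if dec a then t else \<sigma> t) else (if dec a then n + 1 - \<sigma> t else n + 1 - t))" for a t
  define \<Phi> where "\<Phi> i = (\<Sum>a\<in>{1..k}. weight a (i a))" for i
  have bounded: "\<not> gi c x" "\<not> gd c x" if "x \<le> 0" for c x
    using that unfolding gi_def gd_def G_def by auto
  \<comment> \<open>Every shaded square has a corner whose prescribed direction leads into it; the
    alternatives are NE, SW, SE and NW, in this order.\<close>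
  have corner: "\<exists>c\<in>{1..k}. c = a \<and> \<pi> c = b \<and> inc c \<or> c = a + 1 \<and> \<pi> c = b + 1 \<and> \<not> inc c
      \<or> c = a \<and> \<pi> c = b + 1 \<and> dec c \<or> c = a + 1 \<and> \<pi> c = b \<and> \<not> dec c" if ab: "(a, b) \<in> R" for a b
  proof -
    have abQ: "(int a, int b) \<in> Q"
      using ab by (simp add: Q_def)
    \<comment> \<open>As the square alone is no enclosed diagonal with \<open>h = 1\<close>, one of
      the two diagonals through it meets the graph in a corner.\<close>
    have "\<not> enclosed_diagonal ((k, \<pi>), R) ((int a, int b), 1, 1)"
      using no_diag by blast
    with abQ consider
        "(int a, int b) \<in> G \<or> (int a + 1, int b + 1) \<in> G"
      | "(int a, int b + 1) \<in> G \<or> (int a + 1, int b) \<in> G"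
      by (auto simp: Let_def G_def Q_def simp del: perm_graph.simps)
    then show ?thesis
    proof cases
      case 1
      define c where "c = int b - int a"
      have "(gi c (int a) \<and> chain_gap (gi c) (qi c) (int a)) \<or>
          (gi c (int a + 1) \<and> \<not> chain_gap (gi c) (qi c) (int a + 1))"
      proof (rule chain_gap_choice)
        fix i h :: int
        assume h: "h \<ge> 2" "\<forall>x. 0 \<le> x \<and> x < h \<longrightarrow> qi c (i + x)"
          "\<forall>x. 1 \<le> x \<and> x < h \<longrightarrow> gi c (i + x)" "\<not> gi c i" "\<not> gi c (i + h)"
        then have "enclosed_diagonal ((k, \<pi>), R) ((i, c + i), 1, h)"
          by (auto simp: Let_def G_def Q_def qi_def gi_def add.assoc simp del: perm_graph.simps)
        then show False using no_diag by blast
      next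
        show "qi c (int a)" "gi c (int a) \<or> gi c (int a + 1)"
          using 1 abQ by (auto simp: qi_def gi_def c_def algebra_simps)
      qed (rule bounded)
      then show ?thesis
      proof
        assume *: "gi c (int a) \<and> chain_gap (gi c) (qi c) (int a)"
        then have "(int a, int b) \<in> G"
          by (simp add: gi_def c_def)
        then have a: "a \<in> {1..k}" "\<pi> a = b"
          unfolding G_def mem_perm_graph_iff by auto
        then have "inc a"
          using * by (simp add: inc_def c_def)
        with a show ?thesis by blast
      next
        assume *: "gi c (int a + 1) \<and> \<not> chain_gap (gi c) (qi c) (int a + 1)"
        then have "(int (a + 1), int (b + 1)) \<in> G"
          by (auto simp: gi_def c_def algebra_simps)
        then have "a + 1 \<in> {1..k}" "\<pi> (a + 1) = b + 1"
          unfolding G_def mem_perm_graph_iff by auto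
        moreover from this have "\<not> inc (a + 1)"
          using * by (simp add: inc_def c_def add.commute)
        ultimately show ?thesis by blast
      qed
    next
      case 2
      define c where "c = int b + int a"
      have "(gd c (int a) \<and> chain_gap (gd c) (qd c) (int a)) \<or>
          (gd c (int a + 1) \<and> \<not> chain_gap (gd c) (qd c) (int a + 1))"
      proof (rule chain_gap_choice)
        fix i h :: int
        assume h: "h \<ge> 2" "\<forall>x. 0 \<le> x \<and> x < h \<longrightarrow> qd c (i + x)"
          "\<forall>x. 1 \<le> x \<and> x < h \<longrightarrow> gd c (i + x)" "\<not> gd c i" "\<not> gd c (i + h)"
        then have "enclosed_diagonal ((k, \<pi>), R) ((i, c - i), - 1, h)"
          by (auto simp: Let_def G_def Q_def qd_def gd_def algebra_simps simp del: perm_graph.simps)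
        then show False using no_diag by blast
      next
        show "qd c (int a)" "gd c (int a) \<or> gd c (int a + 1)"
          using 2 abQ by (auto simp: qd_def gd_def c_def algebra_simps)
      qed (rule bounded)
      then show ?thesis
      proof
        assume *: "gd c (int a) \<and> chain_gap (gd c) (qd c) (int a)"
        then have "(int a, int (b + 1)) \<in> G"
          by (auto simp: gd_def c_def algebra_simps)
        then have "a \<in> {1..k}" "\<pi> a = b + 1"
          unfolding G_def mem_perm_graph_iff by auto
        moreover from this have "dec a"
          using * by (simp add: dec_def c_def add.commute)
        ultimately show ?thesis by blast
      next
        assume *: "gd c (int a + 1) \<and> \<not> chain_gap (gd c) (qd c) (int a + 1)"
        then have "(int (a + 1), int b) \<in> G"
          by (auto simp: gd_def c_def algebra_simps)
        then have "a + 1 \<in> {1..k}" "\<pi> (a + 1) = b"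
          unfolding G_def mem_perm_graph_iff by auto
        moreover from this have "\<not> dec (a + 1)"
          using * by (simp add: dec_def c_def add.commute)
        ultimately show ?thesis by blast
      qed
    qed
  qed
  have in_n: "\<sigma> t \<in> {1..n}" if "t \<in> {1..n}" for t
    using permutes_in_image[OF \<sigma>] that by blast
  have weight_le: "weight a t \<le> n + 1" if "t \<in> {1..n}" for a t
    using in_n[OF that] that unfolding weight_def by auto
  have \<Phi>_le: "\<Phi> i < k * (n + 1) + 1" if "occurrence (k, \<pi>) (n, \<sigma>) i" for i
  proof -
    have "\<Phi> i \<le> (\<Sum>a\<in>{1..k}. n + 1)"
      unfolding \<Phi>_def by (intro sum_mono weight_le occurrenceD(3)[OF that])
    then show ?thesis by simp
  qed
  obtain i0 where "occurrence (k, \<pi>) (n, \<sigma>) i0"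
    using cont unfolding contains_def by blast
  then obtain i where occ: "occurrence (k, \<pi>) (n, \<sigma>) i"
    and max: "\<And>i'. occurrence (k, \<pi>) (n, \<sigma>) i' \<Longrightarrow> \<Phi> i' \<le> \<Phi> i"
    using ex_has_greatest_nat[of "occurrence (k, \<pi>) (n, \<sigma>)" i0 \<Phi> "k * (n + 1) + 1"] \<Phi>_le by blast
  have "False" if ab: "(a, b) \<in> R" and t: "t \<in> {1..n}"
    and I: "with_boundary k n i a < t" "t < with_boundary k n i (a + 1)"
    and V: "with_boundary k n (sorted_values k \<sigma> i) b < \<sigma> t"
      "\<sigma> t < with_boundary k n (sorted_values k \<sigma> i) (b + 1)" for a b t
  proof -
    have "a \<le> k" "b \<le> k"
      using ab R by auto
    note box = box_bounds[OF \<pi> \<sigma> occ I V this]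
    obtain c where c: "c \<in> {1..k}" "c = a \<and> \<pi> c = b \<and> inc c \<or> c = a + 1 \<and> \<pi> c = b + 1 \<and> \<not> inc c
      \<or> c = a \<and> \<pi> c = b + 1 \<and> dec c \<or> c = a + 1 \<and> \<pi> c = b \<and> \<not> dec c"
      using corner[OF ab] by blast
    have occ': "occurrence (k, \<pi>) (n, \<sigma>) (i(c := t))"
      by (rule occurrence_move_corner[OF \<pi> occ t, of a b]) (use box c in auto)
    have ic: "i c \<in> {1..n}"
      using occurrenceD(3)[OF occ c(1)] .
    \<comment> \<open>These bounds make the natural-number subtractions in \<open>weight\<close>
      strictly decreasing.\<close>
    have "t \<le> n" "\<sigma> t \<le> n" "i c \<le> n" "\<sigma> (i c) \<le> n"
      using ic t in_n[OF ic] in_n[OF t] by simp_all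
    then have "weight c (i c) < weight c t"
      using c(2) by (elim disjE conjE) (use box[OF c(1)] in \<open>simp_all add: weight_def diff_less_mono2\<close>)
    then have "\<Phi> i < \<Phi> (i(c := t))"
      unfolding \<Phi>_def using c(1) by (intro sum_strict_mono_ex1) auto
    then show False
      using max[OF occ'] by simp
  qed
  then have "mesh_occurrence ((k, \<pi>), R) (n, \<sigma>) i"
    using occ by (auto simp: Let_def simp del: occurrence.simps)
  then show ?thesis
    unfolding mesh_contains_def by blast
qed

lemma mesh_contains_imp_contains:
  "mesh_contains (n, \<sigma>) ((k, \<pi>), R) \<Longrightarrow> contains (n, \<sigma>) (k, \<pi>)"
  unfolding mesh_contains_def contains_def by (auto simp del: occurrence.simps)

section \<open>The containment order\<close>

lemma contains_trans:
  assumes "contains s p" "contains p q"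
  shows "contains s q"
proof -
  obtain n \<sigma> k \<pi> m \<tau> where eqs: "s = (n, \<sigma>)" "p = (k, \<pi>)" "q = (m, \<tau>)"
    by (metis surj_pair)
  obtain i j where ij: "occurrence (k, \<pi>) (n, \<sigma>) i" "occurrence (m, \<tau>) (k, \<pi>) j"
    using assms unfolding contains_def eqs by blast
  have "occurrence (m, \<tau>) (n, \<sigma>) (i \<circ> j)"
    using strict_mono_onD[OF occurrenceD(1)[OF ij(1)]] strict_mono_onD[OF occurrenceD(1)[OF ij(2)]]
      occurrenceD(3,4)[OF ij(1)] occurrenceD(3,4)[OF ij(2)]
    by (auto simp: strict_mono_on_def simp del: atLeastAtMost_iff)
  then show ?thesis
    unfolding contains_def eqs by blast
qed

lemma occurrence_imp_size_le:
  assumes "occurrence (k, \<pi>) (n, \<sigma>) i"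
  shows "k \<le> n"
proof -
  have "inj_on i {1..k}"
    using strict_mono_on_imp_inj_on[OF occurrenceD(1)[OF assms]] .
  then have "card {1..k} \<le> card {1..n}"
    using occurrenceD(2)[OF assms] by (intro card_inj_on_le[of i]) simp_all
  then show ?thesis by simp
qed

text \<open>Equal sizes force the occurrence to be the identity on indices, and two permutations of
  the same size in the same relative order agree.\<close>

lemma contains_antisym:
  assumes "p \<in> perms" "q \<in> perms" "contains p q" "contains q p"
  shows "p = q"
proof -
  obtain k \<pi> m \<tau> where eqs: "p = (k, \<pi>)" "q = (m, \<tau>)"
    by (metis surj_pair)
  obtain i j where "occurrence (m, \<tau>) (k, \<pi>) i" "occurrence (k, \<pi>) (m, \<tau>) j"
    using assms(3,4) unfolding contains_def eqs by blast
  moreover from this have mk: "m = k"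
    by (meson occurrence_imp_size_le le_antisym)
  ultimately have occ: "occurrence (k, \<tau>) (k, \<pi>) i"
    by simp
  have perm: "\<pi> permutes {1..k}" "\<tau> permutes {1..k}"
    using assms(1,2) by (auto simp: perms_def eqs mk)
  have "inj_on i {1..k}" "i ` {1..k} \<subseteq> {1..k}"
    using strict_mono_on_imp_inj_on occurrenceD(1,2)[OF occ] by blast+
  then have im: "i ` {1..k} = {1..k}"
    by (intro endo_inj_surj) auto
  have id: "strict_mono_on {1..k} (\<lambda>x::nat. x)"
    by (auto simp: strict_mono_on_def)
  have i_id: "i a = a" if "a \<in> {1..k}" for a
    using strict_mono_on_unique[OF occurrenceD(1)[OF occ] id _ that] im by simp
  have "\<tau> a = \<pi> a" if a: "a \<in> {1..k}" for a
  proof -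
    have "\<tau> a \<in> {1..k}"
      using permutes_in_image[OF perm(2)] a by blast
    from strict_mono_on_unique[OF occurrence_standardize(1)[OF perm(2) occ] id _ this]
    have "\<pi> (i a) = \<tau> a"
      using occurrence_standardize(2)[OF perm(2) occ] im permutes_image[OF perm(1)]
        permutes_inverses[OF perm(2)] by simp
    then show ?thesis
      using i_id[OF a] by simp
  qed
  then have "\<pi> = \<tau>"
    using perm by (metis ext permutes_def)
  then show ?thesis
    using mk eqs by simp
qed

lemma contains_refl: "contains p p"
proof -
  have "occurrence p p (\<lambda>x. x)"
    by (cases p) (auto simp: strict_mono_on_def)
  then show ?thesis
    unfolding contains_def by blast
qed

text \<open>In the identity occurrence neighbouring grid columns differ by 1, so no position lies
  strictly inside a box.\<close>

lemma mesh_contains_self: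
  assumes \<pi>: "\<pi> permutes {1..k}"
  shows "mesh_contains (k, \<pi>) ((k, \<pi>), R)"
proof -
  have "occurrence (k, \<pi>) (k, \<pi>) (\<lambda>x. x)"
    by (auto simp: strict_mono_on_def)
  then have "mesh_occurrence ((k, \<pi>), R) (k, \<pi>) (\<lambda>x. x)"
    by (auto simp: with_boundary_def Let_def split: if_splits)
  then show ?thesis
    unfolding mesh_contains_def by blast
qed

section \<open>Insertion and deletion of one entry\<close>

text \<open>This is the increasing enumeration of the natural numbers other than \<open>p\<close>.
  It relabels both positions and values when an entry is inserted.\<close>

definition skip :: "nat \<Rightarrow> nat \<Rightarrow> nat" where
  "skip p t = (if t < p then t else t + 1)"

lemma skip_less_iff [simp]: "skip p a < skip p b \<longleftrightarrow> a < b"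
  by (auto simp: skip_def)

lemma strict_mono_on_skip: "strict_mono_on A (skip p)"
  by (auto simp: strict_mono_on_def)

lemma skip_image:
  assumes "p \<in> {1..k + 1}"
  shows "skip p ` {1..k} = {1..k + 1} - {p}"
proof (intro equalityI subsetI)
  fix x assume "x \<in> {1..k + 1} - {p}"
  then have "x = skip p (if x < p then x else x - 1)" "(if x < p then x else x - 1) \<in> {1..k}"
    using assms by (auto simp: skip_def)
  then show "x \<in> skip p ` {1..k}" by blast
qed (use assms in \<open>auto simp: skip_def\<close>)

text \<open>Exactly one index is left out, and it determines the increasing enumeration of the
  others.\<close>

lemma strict_mono_on_eq_skip:
  fixes i :: "nat \<Rightarrow> nat"
  assumes "strict_mono_on {1..k} i" "i ` {1..k} \<subseteq> {1..k + 1}"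
  obtains q where "q \<in> {1..k + 1}" "\<And>a. a \<in> {1..k} \<Longrightarrow> i a = skip q a"
proof -
  have "card (i ` {1..k}) = k"
    using assms(1) by (simp add: card_image strict_mono_on_imp_inj_on)
  then have "card ({1..k + 1} - i ` {1..k}) = 1"
    using card_Diff_subset[OF _ assms(2)] by simp
  then obtain q where q: "{1..k + 1} - i ` {1..k} = {q}"
    by (rule card_1_singletonE)
  then have "q \<in> {1..k + 1}" "i ` {1..k} = {1..k + 1} - {q}"
    using assms(2) by blast+
  then show thesis
    using that strict_mono_on_unique[OF assms(1) strict_mono_on_skip] skip_image by metis
qed

text \<open>Leaving out position \<open>q\<close> leaves out precisely the value
  \<open>\<sigma> q\<close>, so \<open>skip (\<sigma> q)\<close> enumerates the remaining values in
  increasing order.\<close>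

lemma occurrence_skip_values:
  assumes \<pi>: "\<pi> permutes {1..k}" and \<sigma>: "\<sigma> permutes {1..k + 1}" and q: "q \<in> {1..k + 1}"
    and occ: "occurrence (k, \<pi>) (k + 1, \<sigma>) i" and i: "\<And>a. a \<in> {1..k} \<Longrightarrow> i a = skip q a"
  shows "b \<in> {1..k} \<Longrightarrow> sorted_values k \<sigma> i b = skip (\<sigma> q) b"
    and "a \<in> {1..k} \<Longrightarrow> \<sigma> (skip q a) = skip (\<sigma> q) (\<pi> a)"
proof -
  have \<sigma>q: "\<sigma> q \<in> {1..k + 1}"
    using permutes_in_image[OF \<sigma>] q by blast
  have "i ` {1..k} = skip q ` {1..k}"
    using i by (intro image_cong) auto
  then have "\<sigma> ` i ` {1..k} = \<sigma> ` ({1..k + 1} - {q})"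
    using skip_image[OF q] by simp
  also have "\<dots> = {1..k + 1} - {\<sigma> q}"
    using permutes_image[OF \<sigma>] permutes_inj[OF \<sigma>] by (simp add: image_set_diff)
  also have "\<dots> = skip (\<sigma> q) ` {1..k}"
    using skip_image[OF \<sigma>q] by simp
  finally have im: "\<sigma> ` i ` {1..k} = skip (\<sigma> q) ` {1..k}" .
  show *: "sorted_values k \<sigma> i b = skip (\<sigma> q) b" if "b \<in> {1..k}" for b
    unfolding sorted_values_def im using that
    by (intro sorted_list_of_set_image_nth strict_mono_on_skip)
  show "\<sigma> (skip q a) = skip (\<sigma> q) (\<pi> a)" if a: "a \<in> {1..k}"
  proof -
    have "\<pi> a \<in> {1..k}"
      using permutes_in_image[OF \<pi>] a by blast
    then show ?thesis
      using * occurrence_sorted_values[OF \<pi> occ a] i[OF a] by simp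
  qed
qed

text \<open>The entry left out by the occurrence lies inside the square
  \<open>(q - 1, \<sigma> q - 1)\<close> of the grid of that occurrence.\<close>

lemma mesh_occurrence_skip_not_shaded:
  assumes \<pi>: "\<pi> permutes {1..k}" and \<sigma>: "\<sigma> permutes {1..k + 1}" and q: "q \<in> {1..k + 1}"
    and mocc: "mesh_occurrence ((k, \<pi>), R) (k + 1, \<sigma>) i" and i: "\<And>a. a \<in> {1..k} \<Longrightarrow> i a = skip q a"
  shows "(q - 1, \<sigma> q - 1) \<notin> R"
proof
  assume sh: "(q - 1, \<sigma> q - 1) \<in> R"
  have occ: "occurrence (k, \<pi>) (k + 1, \<sigma>) i"
    using mocc by (simp del: occurrence.simps)
  have \<sigma>q: "\<sigma> q \<in> {1..k + 1}"
    using permutes_in_image[OF \<sigma>] q by blast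
  \<comment> \<open>Used for columns with \<open>s = q\<close> and for rows with
    \<open>s = \<sigma> q\<close>: the grid lines next to a skipped \<open>s\<close> are
    \<open>s - 1\<close> and \<open>s + 1\<close>, boundary lines included.\<close>
  have *: "with_boundary k (k + 1) f (s - 1) < s \<and> s < with_boundary k (k + 1) f (s - 1 + 1)"
    if "s \<in> {1..k + 1}" "\<And>a. a \<in> {1..k} \<Longrightarrow> f a = skip s a" for f s
  proof -
    have "with_boundary k (k + 1) f (s - 1) < s"
      using that(1) that(2)[of "s - 1"] by (cases "s = 1") (force simp: with_boundary_def skip_def)+
    moreover have "s < with_boundary k (k + 1) f s"
      using that(1) that(2)[of s] by (cases "s = k + 1") (auto simp: with_boundary_def skip_def)
    ultimately show ?thesis
      using that(1) by simp
  qed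
  show False
    using mocc sh q *[OF q i] *[OF \<sigma>q occurrence_skip_values(1)[OF \<pi> \<sigma> q occ i]]
    by (auto simp: Let_def simp del: occurrence.simps)
qed

text \<open>A change of direction would repeat the value from two places earlier, against
  injectivity.\<close>

lemma unit_steps_linear:
  fixes f :: "nat \<Rightarrow> int"
  assumes "\<And>a. a < m \<Longrightarrow> \<bar>f (a + 1) - f a\<bar> = 1" "inj_on f {..m}"
  shows "\<exists>\<delta>\<in>{- 1, 1}. \<forall>a\<le>m. f a = f 0 + \<delta> * int a"
  using assms
proof (induction m)
  case 0
  then show ?case by auto
next
  case (Suc m)
  have "inj_on f {..m}"
    using Suc.prems(2) by (rule inj_on_subset) auto
  then obtain \<delta> where \<delta>: "\<delta> \<in> {- 1, 1}" "\<And>a. a \<le> m \<Longrightarrow> f a = f 0 + \<delta> * int a"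
    using Suc.IH Suc.prems(1) by (metis less_SucI)
  have step: "f (m + 1) = f m + 1 \<or> f (m + 1) = f m - 1"
    using Suc.prems(1)[of m] by auto
  show ?case
  proof (cases m)
    case 0
    then have "\<forall>a\<le>Suc m. f a = f 0 + (f 1 - f 0) * int a"
      by (auto simp: le_Suc_eq)
    moreover have "f 1 - f 0 \<in> {- 1, 1}"
      using step 0 by auto
    ultimately show ?thesis by blast
  next
    case (Suc l)
    have "f (Suc m) \<noteq> f l"
      using inj_onD[OF Suc.prems(2), of "Suc m" l] Suc by auto
    then have "f (Suc m) = f m + \<delta>"
      using step \<delta>(1) \<delta>(2)[of m] \<delta>(2)[of l] Suc by (auto simp: algebra_simps)
    then have "f (Suc m) = f 0 + \<delta> * int (Suc m)"
      using \<delta>(2)[of m] by (simp add: algebra_simps)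
    then have "\<forall>a\<le>Suc m. f a = f 0 + \<delta> * int a"
      using \<delta>(2) le_Suc_eq by metis
    then show ?thesis using \<delta>(1) by blast
  qed
qed


text \<open>
  The hypotheses say that deleting the entry at \<open>p\<close> and deleting the entry at \<open>q\<close> leave the same
  pattern \<open>\<pi>\<close>.
\<close>

lemma deletion_run:
  assumes \<sigma>: "\<sigma> permutes {1..k + 1}" and pq: "p \<in> {1..k + 1}" "q \<in> {1..k + 1}"
    and p: "\<And>a. a \<in> {1..k} \<Longrightarrow> \<sigma> (skip p a) = skip (\<sigma> p) (\<pi> a)"
    and q: "\<And>a. a \<in> {1..k} \<Longrightarrow> \<sigma> (skip q a) = skip (\<sigma> q) (\<pi> a)"
  shows "\<exists>\<delta>\<in>{- 1, 1}. \<forall>a\<in>{min p q..max p q}. int (\<sigma> a) = int (\<sigma> p) + \<delta> * (int a - int p)"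
proof -
  have run: "\<exists>\<delta>\<in>{- 1, 1}. \<forall>a\<in>{p..q}. int (\<sigma> a) = int (\<sigma> p) + \<delta> * (int a - int p)"
    if "p \<in> {1..k + 1}" "q \<in> {1..k + 1}" "p \<le> q"
      and p: "\<And>a. a \<in> {1..k} \<Longrightarrow> \<sigma> (skip p a) = skip (\<sigma> p) (\<pi> a)"
      and q: "\<And>a. a \<in> {1..k} \<Longrightarrow> \<sigma> (skip q a) = skip (\<sigma> q) (\<pi> a)" for p q
  proof -
    define f where "f x = int (\<sigma> (p + x))" for x
    have inj: "inj_on f A" for A
      by (auto simp: f_def inj_on_def inj_eq[OF permutes_inj[OF \<sigma>]])
    have "\<bar>f (x + 1) - f x\<bar> = 1" if x: "x < q - p" for x
    proof -
      have "p + x \<in> {1..k}"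
        using that \<open>p \<in> {1..k + 1}\<close> \<open>q \<in> {1..k + 1}\<close> by auto
      \<comment> \<open>The index \<open>p + x\<close> is shifted by \<open>skip p\<close> but fixed
        by \<open>skip q\<close>. Two consecutive values of \<open>\<sigma>\<close> thus arise from
        the same \<open>\<pi> (p + x)\<close>, each raised by 0 or 1; being distinct, they differ by
        exactly 1.\<close>
      then have "\<sigma> (p + x + 1) = skip (\<sigma> p) (\<pi> (p + x))" "\<sigma> (p + x) = skip (\<sigma> q) (\<pi> (p + x))"
        using p[of "p + x"] q[of "p + x"] x by (auto simp: skip_def less_diff_conv add.commute)
      moreover have "\<sigma> (p + x + 1) \<noteq> \<sigma> (p + x)"
        using permutes_inj[OF \<sigma>] by (metis injD n_not_Suc_n Suc_eq_plus1)
      ultimately show ?thesis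
        by (auto simp: f_def skip_def split: if_splits)
    qed
    from unit_steps_linear[OF this inj]
    obtain \<delta> where \<delta>: "\<delta> \<in> {- 1, 1}" "\<And>x. x \<le> q - p \<Longrightarrow> f x = f 0 + \<delta> * int x"
      by blast
    have "int (\<sigma> a) = int (\<sigma> p) + \<delta> * (int a - int p)" if "a \<in> {p..q}" for a
      using \<delta>(2)[of "a - p"] that by (auto simp: f_def of_nat_diff)
    then show ?thesis using \<delta>(1) by blast
  qed
  show ?thesis
  proof (cases "p \<le> q")
    case True
    then show ?thesis using run[OF pq True p q] by simp
  next
    case False
    then have "q \<le> p" by simp
    from run[OF pq(2,1) this q p] obtain \<delta> where \<delta>: "\<delta> \<in> {- 1, 1}"
      "\<And>a. a \<in> {q..p} \<Longrightarrow> int (\<sigma> a) = int (\<sigma> q) + \<delta> * (int a - int q)"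
      by blast
    have "int (\<sigma> a) = int (\<sigma> p) + \<delta> * (int a - int p)" if "a \<in> {q..p}" for a
      using \<delta>(2)[OF that] \<delta>(2)[of p] \<open>q \<le> p\<close> by (simp add: algebra_simps)
    moreover have "{min p q..max p q} = {q..p}"
      using \<open>q \<le> p\<close> by simp
    ultimately show ?thesis
      using \<delta>(1) by metis
  qed
qed

lemma insertion_exists:
  assumes \<pi>: "\<pi> permutes {1..k}" and p: "p \<in> {1..k + 1}" and v: "v \<in> {1..k + 1}"
  obtains \<sigma> where "\<sigma> permutes {1..k + 1}" "\<sigma> p = v"
    "\<And>a. a \<in> {1..k} \<Longrightarrow> \<sigma> (skip p a) = skip v (\<pi> a)"
proof -
  define \<sigma> where "\<sigma> t = (if t = p then v else if t \<in> {1..k + 1}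
    then skip v (\<pi> (if t < p then t else t - 1)) else t)" for t
  have \<sigma>p: "\<sigma> p = v"
    by (simp add: \<sigma>_def)
  have \<sigma>_skip: "\<sigma> (skip p a) = skip v (\<pi> a)" if "a \<in> {1..k}" for a
    using that by (auto simp: \<sigma>_def skip_def)
  have "{1..k + 1} = insert p (skip p ` {1..k})"
    using skip_image[OF p] p by auto
  then have "\<sigma> ` {1..k + 1} = insert v ((\<lambda>a. \<sigma> (skip p a)) ` {1..k})"
    using \<sigma>p by (simp add: image_image)
  also have "(\<lambda>a. \<sigma> (skip p a)) ` {1..k} = skip v ` \<pi> ` {1..k}"
    unfolding image_image using \<sigma>_skip by (intro image_cong) auto
  also have "\<dots> = {1..k + 1} - {v}"
    using skip_image[OF v] permutes_image[OF \<pi>] by simp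
  also have "insert v \<dots> = {1..k + 1}"
    using v by auto
  finally have im: "\<sigma> ` {1..k + 1} = {1..k + 1}" .
  then have "inj_on \<sigma> {1..k + 1}"
    by (intro eq_card_imp_inj_on) auto
  then have "\<sigma> permutes {1..k + 1}"
    using im p by (intro bij_imp_permutes) (auto simp: bij_betw_def \<sigma>_def)
  then show thesis
    using that \<sigma>p \<sigma>_skip by blast
qed

section \<open>The permutation built from an enclosed diagonal\<close>

lemma enclosed_diagonal_shaded:
  assumes "enclosed_diagonal (p, R) ((i, j), \<epsilon>, h)"
  obtains a b where "i = int a" "j = int b" "(a, b) \<in> R"
proof -
  have "(i, j) \<in> map_prod int int ` R"
    using assms by (cases "h = 1") (auto simp: Let_def)
  then show thesis using that by auto
qed

lemma enclosed_diagonal_imp_witness: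
  assumes \<pi>: "\<pi> permutes {1..k}" and R: "R \<subseteq> {0..k} \<times> {0..k}"
    and diag: "enclosed_diagonal ((k, \<pi>), R) d"
  obtains \<sigma> where "\<sigma> permutes {1..k + 1}" "contains (k + 1, \<sigma>) (k, \<pi>)"
    "\<not> mesh_contains (k + 1, \<sigma>) ((k, \<pi>), R)"
proof -
  obtain i' j' \<epsilon> h where d: "d = ((i', j'), \<epsilon>, h)"
    by (metis surj_pair)
  obtain i j where ij: "i' = int i" "j' = int j" "(i, j) \<in> R"
    using diag unfolding d by (rule enclosed_diagonal_shaded)
  define G where "G = perm_graph (k, \<pi>)"
  define Q where "Q = map_prod int int ` R"
  have \<epsilon>: "h \<ge> 1" "\<epsilon> \<in> {- 1, 1}"
    using diag by (auto simp: d Let_def)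
  have one: "(int i, int j) \<notin> G" "(int i + 1, int j) \<notin> G" "(int i, int j + 1) \<notin> G"
    "(int i + 1, int j + 1) \<notin> G" if "h = 1"
    using diag that by (auto simp: d Let_def ij G_def simp del: perm_graph.simps)
  have inc: "\<And>x. 0 \<le> x \<Longrightarrow> x < h \<Longrightarrow> (int i + x, int j + x) \<in> Q"
    "\<And>x. 1 \<le> x \<Longrightarrow> x < h \<Longrightarrow> (int i + x, int j + x) \<in> G" "(int i, int j) \<notin> G"
    "(int i + h, int j + h) \<notin> G" if "h \<ge> 2" "\<epsilon> = 1"
    using diag that by (auto simp: d Let_def ij G_def Q_def simp del: perm_graph.simps)
  have dec: "\<And>x. 0 \<le> x \<Longrightarrow> x < h \<Longrightarrow> (int i + x, int j - x) \<in> Q"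
    "\<And>x. 1 \<le> x \<Longrightarrow> x < h \<Longrightarrow> (int i + x, int j + 1 - x) \<in> G" "(int i, int j + 1) \<notin> G"
    "(int i + h, int j + 1 - h) \<notin> G" if "h \<ge> 2" "\<epsilon> = - 1"
    using diag that by (auto simp: d Let_def ij G_def Q_def simp del: perm_graph.simps)
  have same_col: "y = y'" if "(x, y) \<in> G" "(x, y') \<in> G" for x y y'
    using that by (auto simp: G_def)
  have same_row: "x = x'" if "(x, y) \<in> G" "(x', y) \<in> G" for x x' y
    using that injD[OF permutes_inj[OF \<pi>]] by (auto simp: G_def)
  \<comment> \<open>Position \<open>i + 1\<close> and value \<open>j + 1\<close> put the new entry
    inside the square \<open>(i, j)\<close>, the first one of the enclosed diagonal.\<close>
  define p where "p = i + 1"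
  have p: "p \<in> {1..k + 1}" and j: "j + 1 \<in> {1..k + 1}"
    using ij(3) R by (auto simp: p_def)
  obtain \<sigma> where \<sigma>: "\<sigma> permutes {1..k + 1}" and \<sigma>p: "\<sigma> p = j + 1"
    and \<sigma>_skip: "\<And>a. a \<in> {1..k} \<Longrightarrow> \<sigma> (skip p a) = skip (j + 1) (\<pi> a)"
    using insertion_exists[OF \<pi> p j] by metis
  have \<sigma>_skip': "\<And>a. a \<in> {1..k} \<Longrightarrow> \<sigma> (skip p a) = skip (\<sigma> p) (\<pi> a)"
    using \<sigma>_skip \<sigma>p by simp
  have "occurrence (k, \<pi>) (k + 1, \<sigma>) (skip p)"
    using skip_image[OF p] by (auto simp: strict_mono_on_skip \<sigma>_skip)
  then have "contains (k + 1, \<sigma>) (k, \<pi>)"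
    unfolding contains_def by blast
  moreover have "\<not> mesh_contains (k + 1, \<sigma>) ((k, \<pi>), R)"
  proof
    assume "mesh_contains (k + 1, \<sigma>) ((k, \<pi>), R)"
    then obtain f where f: "mesh_occurrence ((k, \<pi>), R) (k + 1, \<sigma>) f"
      unfolding mesh_contains_def by blast
    then have occ: "occurrence (k, \<pi>) (k + 1, \<sigma>) f"
      by (simp del: occurrence.simps)
    note occurrenceD(1,2)[OF this]
    then obtain q where q: "q \<in> {1..k + 1}" and fq: "\<And>a. a \<in> {1..k} \<Longrightarrow> f a = skip q a"
      using strict_mono_on_eq_skip by metis
    \<comment> \<open>The entry left out must sit in an unshaded square. Each position of
      \<open>q\<close> relative to \<open>p\<close> contradicts this or the shape of the enclosed
      diagonal.\<close>
    have free: "(q - 1, \<sigma> q - 1) \<notin> R"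
      using mesh_occurrence_skip_not_shaded[OF \<pi> \<sigma> q f fq] .
    have "\<sigma> q \<in> {1..k + 1}"
      using permutes_in_image[OF \<sigma>] q by blast
    then have free': "(int q - 1, int (\<sigma> q) - 1) \<notin> Q"
      using free q mem_shading_iff[of "q - 1" "\<sigma> q - 1" R] by (simp add: Q_def of_nat_diff)
    obtain \<delta> where \<delta>: "\<delta> \<in> {- 1, 1}"
      and run: "\<And>a. a \<in> {min p q..max p q} \<Longrightarrow> int (\<sigma> a) = int (\<sigma> p) + \<delta> * (int a - int p)"
      using deletion_run[OF \<sigma> p q \<sigma>_skip' occurrence_skip_values(2)[OF \<pi> \<sigma> q occ fq]] by blast
    consider "q = p" | "p < q" | "q < p" by linarith
    then show False
    proof cases
      case 1
      then show False
        using free ij(3) \<sigma>p by (simp add: p_def)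
    next
      case 2
      define m where "m = q - p"
      have m: "m \<ge> 1" "q = i + 1 + m"
        using 2 by (auto simp: m_def p_def)
      \<comment> \<open>With the inserted entry removed, the entries of \<open>\<sigma>\<close>
        after \<open>p\<close> up to \<open>q\<close> become points of \<open>\<pi>\<close> in
        columns \<open>i + 1\<close> to \<open>i + m\<close>, on a diagonal through the square
        \<open>(i, j)\<close>.\<close>
      have G: "(int i + x, int j + (if \<delta> = 1 then x else 1 - x)) \<in> G" if "1 \<le> x" "x \<le> int m" for x
      proof -
        define y where "y = nat x"
        have y: "x = int y" "1 \<le> y" "y \<le> m"
          using that by (auto simp: y_def)
        have a: "i + y \<in> {1..k}"
          using y m q by auto
        have "skip p (i + y) = p + y"
          using y by (simp add: skip_def p_def)
        then have "int (skip (j + 1) (\<pi> (i + y))) = int j + 1 + \<delta> * int y"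
          using \<sigma>_skip[OF a] run[of "p + y"] y m \<sigma>p by (simp add: p_def)
        then have "int (\<pi> (i + y)) = int j + (if \<delta> = 1 then x else 1 - x)"
          using \<delta> y by (auto simp: skip_def split: if_splits)
        then show ?thesis
          using a y unfolding G_def by (auto simp: image_iff intro!: bexI[of _ "i + y"])
      qed
      have \<sigma>q: "int (\<sigma> q) - 1 = int j + \<delta> * int m" "int q - 1 = int i + int m"
        using run[of q] 2 \<sigma>p m by (auto simp: p_def algebra_simps)
      have "h \<ge> 2"
        using G[of 1] one m(1) \<epsilon>(1) by (cases "h = 1") (auto split: if_splits)
      show False
      proof (cases "\<epsilon> = 1")
        case True
        note inc = inc[OF \<open>h \<ge> 2\<close> True]
        \<comment> \<open>Column \<open>i + 1\<close> holds only one point, so this run follows the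
          enclosed diagonal. It cannot pass the missing point number \<open>h\<close>, hence
          \<open>m < h\<close> and the square of \<open>q\<close> is shaded.\<close>
        have "\<delta> = 1"
          using G[of 1] m(1) inc(2)[of 1] \<open>h \<ge> 2\<close> same_col[of "int i + 1" "int j" "int j + 1"]
          by (auto split: if_splits)
        then have "int m < h"
          using G[of h] inc(4) \<open>h \<ge> 2\<close> by (cases "h \<le> int m") auto
        then show False
          using inc(1)[of "int m"] free' \<sigma>q \<open>\<delta> = 1\<close> by simp
      next
        case False
        then have "\<epsilon> = - 1" using \<epsilon> by simp
        note dec = dec[OF \<open>h \<ge> 2\<close> this]
        have "\<delta> = - 1"
          using G[of 1] m(1) dec(2)[of 1] \<open>h \<ge> 2\<close> same_col[of "int i + 1" "int j" "int j + 1"] \<delta>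
          by (auto split: if_splits)
        then have "int m < h"
          using G[of h] dec(4) \<open>h \<ge> 2\<close>
          by (cases "h \<le> int m") (auto simp: algebra_simps)
        then show False
          using dec(1)[of "int m"] free' \<sigma>q \<open>\<delta> = - 1\<close> by simp
      qed
    next
      case 3
      \<comment> \<open>The entry of \<open>\<sigma>\<close> just before \<open>p\<close> would give
        a left corner of the first square. One left corner is excluded by the definition of an
        enclosed diagonal, the other by the first point of the run, which occupies the same
        row.\<close>
      then have a: "i \<in> {1..k}"
        using p q by (auto simp: p_def)
      have "skip p i = i"
        by (simp add: skip_def p_def)
      then have "int (skip (j + 1) (\<pi> i)) = int j + 1 - \<delta>"
        using \<sigma>_skip[OF a] run[of i] 3 \<sigma>p by (simp add: p_def)
      then have "\<pi> i = (if \<delta> = 1 then j else j + 1)"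
        using \<delta> by (auto simp: skip_def split: if_splits)
      then have G: "(int i, int j) \<in> G \<or> (int i, int j + 1) \<in> G"
        using a unfolding G_def by (auto simp: image_iff split: if_splits)
      then have "h \<ge> 2"
        using one \<epsilon>(1) by (cases "h = 1") auto
      show False
      proof (cases "\<epsilon> = 1")
        case True
        note inc = inc[OF \<open>h \<ge> 2\<close> True]
        show False
          using G inc(3) inc(2)[of 1] \<open>h \<ge> 2\<close> same_row[of "int i" "int j + 1" "int i + 1"] by auto
      next
        case False
        then have "\<epsilon> = - 1" using \<epsilon> by simp
        note dec = dec[OF \<open>h \<ge> 2\<close> this]
        show False
          using G dec(3) dec(2)[of 1] \<open>h \<ge> 2\<close> same_row[of "int i" "int j" "int i + 1"] by auto
      qed
    qed
  qed
  ultimately show thesis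
    using that \<sigma> by blast
qed

section \<open>Classical descriptions and their minimality\<close>

lemma Av_set_downward_closed:
  assumes "S \<subseteq> perms" "s \<in> Av_set S" "p \<in> perms" "contains s p"
  shows "p \<in> Av_set S"
  using assms contains_trans unfolding Av_set_def Av_def by blast

theorem theorem3p5:
  fixes k :: nat and \<pi> :: "nat \<Rightarrow> nat" and R :: "(nat \<times> nat) set"
  assumes "1 \<le> k" and "\<pi> permutes {1..k}" and "R \<subseteq> {0..k} \<times> {0..k}"
  shows "((\<exists>S. classical_description ((k, \<pi>), R) S) \<longleftrightarrow>
            \<not> (\<exists>d. enclosed_diagonal ((k, \<pi>), R) d)) \<and>
         (\<not> (\<exists>d. enclosed_diagonal ((k, \<pi>), R) d) \<longrightarrow>
            (\<forall>S. minimal_classical_description ((k, \<pi>), R) S \<longrightarrow> S = {(k, \<pi>)}) \<and>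
            mesh_Av ((k, \<pi>), R) = Av (k, \<pi>))"
proof -
  let ?m = "((k, \<pi>), R)"
  have \<pi>_perm: "(k, \<pi>) \<in> perms"
    using assms by (simp add: perms_def)
  have no_description: False
    if S: "classical_description ?m S" and d: "enclosed_diagonal ?m d" for S d
  proof -
    obtain \<sigma> where \<sigma>: "\<sigma> permutes {1..k + 1}" "contains (k + 1, \<sigma>) (k, \<pi>)"
      "\<not> mesh_contains (k + 1, \<sigma>) ?m"
      using enclosed_diagonal_imp_witness[OF assms(2,3) d] by blast
    then have "(k + 1, \<sigma>) \<in> Av_set S"
      using S by (auto simp: classical_description_def mesh_Av_def perms_def)
    then have "(k, \<pi>) \<in> mesh_Av ?m"
      using Av_set_downward_closed[OF _ _ \<pi>_perm \<sigma>(2)] S by (auto simp: classical_description_def)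
    then show False
      using mesh_contains_self[OF assms(2)] by (simp add: mesh_Av_def)
  qed
  have coincident: "mesh_Av ?m = Av (k, \<pi>)" if "\<nexists>d. enclosed_diagonal ?m d"
    using contains_imp_mesh_contains[OF assms(2,3) that] mesh_contains_imp_contains
    by (auto simp: mesh_Av_def Av_def perms_def)
  have description: "classical_description ?m {(k, \<pi>)}" if "\<nexists>d. enclosed_diagonal ?m d"
    using coincident[OF that] \<pi>_perm by (auto simp: classical_description_def Av_set_def Av_def)
  have minimal: "S = {(k, \<pi>)}"
    if no_diag: "\<nexists>d. enclosed_diagonal ?m d" and S: "minimal_classical_description ?m S" for S
  proof -
    \<comment> \<open>The singleton of \<open>(k, \<pi>)\<close> is itself a description, so a
      minimal \<open>S\<close> injects into it and has at most one element.\<close>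
    have S_desc: "S \<subseteq> perms" "Av_set S = Av (k, \<pi>)" "S \<lesssim> {(k, \<pi>)}"
      using S description[OF no_diag] coincident[OF no_diag]
      by (auto simp: minimal_classical_description_def classical_description_def)
    then obtain f where "inj_on f S" "f ` S \<subseteq> {(k, \<pi>)}"
      unfolding lepoll_def by blast
    then have sub: "p = q" if "p \<in> S" "q \<in> S" for p q
      using that by (metis imageI inj_onD singletonD subsetD)
    \<comment> \<open>Since \<open>(k, \<pi>)\<close> contains itself, it contains some
      \<open>p\<close> in \<open>S\<close>. This \<open>p\<close> does not avoid itself, so it lies
      outside \<open>Av_set S\<close> and contains \<open>(k, \<pi>)\<close> in turn.\<close>
    have "(k, \<pi>) \<notin> Av_set S"
      using S_desc(2) contains_refl by (simp add: Av_def)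
    then obtain p where p: "p \<in> S" "contains (k, \<pi>) p"
      using \<pi>_perm by (auto simp: Av_set_def Av_def)
    then have "p \<notin> Av (k, \<pi>)"
      using S_desc(2) contains_refl[of p] by (auto simp: Av_set_def Av_def)
    then have "p = (k, \<pi>)"
      using p S_desc(1) \<pi>_perm by (intro contains_antisym) (auto simp: Av_def)
    then show ?thesis
      using p(1) sub by blast
  qed
  show ?thesis
    using no_description coincident description minimal by blast
qed

end
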